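(* Let the assumptions on the data stated in the context hold. Then, for the iterative scheme $u^{i+1,*}=\mathbb P\big(u^{i,*}-\rho J'(u^{i,*})\big)$ with a given $u^{i,*}\in L^2([0,T];\mathbb R)$, there exists an explicit multiplier $\mu^{i,*}\ge 0$ such that $$\mathbb E\Big[\int_0^T y_t^{i+1,*}\,dt\Big]\le\delta ,$$ where $y_t^{i+1,*}$ is the state corresponding to the control $u^{i+1,*}$.
   Context: Everything is one-dimensional. $T\in(0,\infty)$; $(\Omega,\mathcal F,\{\mathcal F_t\}_{0\le t\le T},P)$ is a complete probability space with the natural filtration generated by a one-dimensional Brownian motion $W_t$. Controls are deterministic functions $u\in L^2([0,T];\mathbb R)$, with inner product $(u,v)=\int_0^T u(t)v(t)\,dt$. For each control $u$, the state $y_t^u$ is the adapted solution of $dy_t^u=b(y_t^u,u)\,dt+\sigma(y_t^u,u)\,dW_t$, $y_0^u=y^0\in\mathbb R$, where the drift is linear: $b(y,u)=b_y'(t)\,y+b_u'(t)\,u+m(t)$ with $b_y',b_u',m$ deterministic functions of $t\in[0,T]$. Assumptions on the data: $b$ and $\sigma$ are continuously differentiable with respect to $y$ and $u$, and there are positive constants $C_b,C_\sigma$ with $|b_y'|+|b_u'|\le C_b$ and $|\sigma_y'|+|\sigma_u'|\le C_\sigma$; the functions $h,j,k:\mathbb R\to\mathbb R$ are continuously differentiable and their derivatives have at most linear growth. Under these assumptions the state equation has a unique solution, square integrable on $[0,T]\times\Omega$. The objective $J(u)=\mathbb E\big[\int_0^T(h(y_t^u)+j(u))\,dt+k(y_T^u)\big]$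 is continuously Fréchet differentiable on $L^2([0,T];\mathbb R)$, and $J'(u)\in L^2([0,T];\mathbb R)$ denotes its gradient. For a given $\delta\in\mathbb R$, $U(\delta)=\{u\in L^2([0,T];\mathbb R):\int_0^T\mathbb E[y_t^u]\,dt-\delta\le 0\}$, which is convex because the drift is linear. $\mathbb P$ is the projection operator from $L^2([0,T];\mathbb R)$ onto $U(\delta)$, satisfying $(\mathbb Pw-w,v-\mathbb Pw)\ge0$ for all $v\in U(\delta)$. The number $\rho$ is a positive constant, and $i=0,1,2,\dots$. Meaning of "multiplier": in the scheme the projection is written in the form $\mathbb P\big(u^{i,*}-\rho J'(u^{i,*})\big)=u^{i,*}-\rho J'(u^{i,*})-\rho\,\mu^{i,*}\,\psi(t)\,b_u'(t)$, where $\psi$ solves $-\psi'(t)=1+\psi(t)b_y'(t)$, $\psi(T)=0$; the real number $\mu^{i,*}$ appearing here is the multiplier. "Explicit" means given by a formula. *)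

theory Defs
  imports "HOL-Probability.Probability"
begin

definition natural_filtration :: "'a measure \<Rightarrow> (real \<Rightarrow> 'a \<Rightarrow> real) \<Rightarrow> real \<Rightarrow> 'a measure" where
  "natural_filtration M W t =
     sigma (space M) {W s -` B \<inter> space M | s B. s \<in> {0..t} \<and> B \<in> sets borel}"

definition augmented_filtration :: "'a measure \<Rightarrow> (real \<Rightarrow> 'a \<Rightarrow> real) \<Rightarrow> real \<Rightarrow> 'a measure" where
  "augmented_filtration M W t =
     sigma (space M) (sets (natural_filtration M W t) \<union> null_sets M)"

definition brownian_motion :: "'a measure \<Rightarrow> real \<Rightarrow> (real \<Rightarrow> 'a \<Rightarrow> real) \<Rightarrow> bool" where
  "brownian_motion M T W \<longleftrightarrow>
     (\<forall>t\<in>{0..T}. W t \<in> borel_measurable M) \<and>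
     (AE \<omega> in M. W 0 \<omega> = 0) \<and>
     (AE \<omega> in M. continuous_on {0..T} (\<lambda>t. W t \<omega>)) \<and>
     (\<forall>s t. 0 \<le> s \<and> s < t \<and> t \<le> T \<longrightarrow>
        distributed M lborel (\<lambda>\<omega>. W t \<omega> - W s \<omega>) (normal_density 0 (sqrt (t - s))) \<and>
        prob_space.indep_set M (sets (natural_filtration M W s))
          {(\<lambda>\<omega>. W t \<omega> - W s \<omega>) -` B \<inter> space M | B. B \<in> sets borel})"

text \<open>
  The triple \<open>(n, \<tau>, \<xi>)\<close> represents the simple process
  \<open>\<Sum>k<n. \<xi>\<^sub>k 1(\<tau>\<^sub>k, \<tau>\<^sub>k\<^sub>+\<^sub>1]\<close> on \<open>[0,T]\<close>, with \<open>\<xi>\<^sub>k\<close> bounded and measurable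
  at time \<open>\<tau>\<^sub>k\<close>.
\<close>

definition simple_process ::
    "'a measure \<Rightarrow> (real \<Rightarrow> 'a measure) \<Rightarrow> real \<Rightarrow> nat \<Rightarrow> (nat \<Rightarrow> real) \<Rightarrow> (nat \<Rightarrow> 'a \<Rightarrow> real) \<Rightarrow> bool" where
  "simple_process M F T n \<tau> \<xi> \<longleftrightarrow>
     (\<forall>k\<le>n. \<tau> k \<in> {0..T}) \<and> (\<forall>k<n. \<tau> k \<le> \<tau> (Suc k)) \<and>
     (\<forall>k<n. \<xi> k \<in> borel_measurable (F (\<tau> k)) \<and> (\<exists>B. \<forall>\<omega>\<in>space M. \<bar>\<xi> k \<omega>\<bar> \<le> B))"

definition simple_value :: "nat \<Rightarrow> (nat \<Rightarrow> real) \<Rightarrow> (nat \<Rightarrow> 'a \<Rightarrow> real) \<Rightarrow> real \<Rightarrow> 'a \<Rightarrow> real" where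
  "simple_value n \<tau> \<xi> t \<omega> = (\<Sum>k<n. \<xi> k \<omega> * indicator {\<tau> k<..\<tau> (Suc k)} t)"

definition simple_integral ::
    "(real \<Rightarrow> 'a \<Rightarrow> real) \<Rightarrow> nat \<Rightarrow> (nat \<Rightarrow> real) \<Rightarrow> (nat \<Rightarrow> 'a \<Rightarrow> real) \<Rightarrow> real \<Rightarrow> 'a \<Rightarrow> real" where
  "simple_integral W n \<tau> \<xi> t \<omega> =
     (\<Sum>k<n. \<xi> k \<omega> * (W (min t (\<tau> (Suc k))) \<omega> - W (min t (\<tau> k)) \<omega>))"

text \<open>
  \<open>Z t\<close> is (a version of) the Ito integral of \<open>\<phi>\<close> over \<open>[0,t]\<close>: the \<open>L\<^sup>2\<close> limit of the integrals
  of simple processes that converge to \<open>\<phi>\<close> in \<open>L\<^sup>2([0,T] \<times> \<Omega>)\<close>. Nonnegative integrals are used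
  because a Bochner integral of a non-integrable function would be 0.
\<close>

definition is_ito_integral ::
    "'a measure \<Rightarrow> (real \<Rightarrow> 'a measure) \<Rightarrow> real \<Rightarrow> (real \<Rightarrow> 'a \<Rightarrow> real) \<Rightarrow>
     (real \<Rightarrow> 'a \<Rightarrow> real) \<Rightarrow> (real \<Rightarrow> 'a \<Rightarrow> real) \<Rightarrow> bool" where
  "is_ito_integral M F T W \<phi> Z \<longleftrightarrow>
     set_borel_measurable (lborel \<Otimes>\<^sub>M M) ({0..T} \<times> space M) (\<lambda>(t, \<omega>). \<phi> t \<omega>) \<and>
     (\<forall>t\<in>{0..T}. Z t \<in> borel_measurable M) \<and>
     (\<exists>n \<tau> \<xi>.
        (\<forall>N. simple_process M F T (n N) (\<tau> N) (\<xi> N)) \<and>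
        (\<lambda>N. \<integral>\<^sup>+\<omega>. (\<integral>\<^sup>+t. ennreal ((simple_value (n N) (\<tau> N) (\<xi> N) t \<omega> - \<phi> t \<omega>)\<^sup>2)
                 * indicator {0..T} t \<partial>lborel) \<partial>M) \<longlonglongrightarrow> 0 \<and>
        (\<forall>t\<in>{0..T}.
          (\<lambda>N. \<integral>\<^sup>+\<omega>. ennreal ((simple_integral W (n N) (\<tau> N) (\<xi> N) t \<omega> - Z t \<omega>)\<^sup>2) \<partial>M)
            \<longlonglongrightarrow> 0))"

definition drift ::
    "(real \<Rightarrow> real) \<Rightarrow> (real \<Rightarrow> real) \<Rightarrow> (real \<Rightarrow> real) \<Rightarrow> real \<Rightarrow> real \<Rightarrow> real \<Rightarrow> real" where
  "drift b\<^sub>y b\<^sub>u m t y u = b\<^sub>y t * y + b\<^sub>u t * u + m t"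

text \<open>
  \<open>Y\<close> is an adapted solution on \<open>[0,T]\<close>, square integrable on \<open>[0,T] \<times> \<Omega>\<close>, of
  \<open>dY = b(t,Y,u) dt + \<sigma>(t,Y,u) dW\<close>, \<open>Y\<^sub>0 = y0\<close>.
\<close>

definition is_state ::
    "'a measure \<Rightarrow> (real \<Rightarrow> 'a measure) \<Rightarrow> real \<Rightarrow> (real \<Rightarrow> 'a \<Rightarrow> real) \<Rightarrow>
     (real \<Rightarrow> real \<Rightarrow> real \<Rightarrow> real) \<Rightarrow> (real \<Rightarrow> real \<Rightarrow> real \<Rightarrow> real) \<Rightarrow> real \<Rightarrow>
     (real \<Rightarrow> real) \<Rightarrow> (real \<Rightarrow> 'a \<Rightarrow> real) \<Rightarrow> bool" where
  "is_state M F T W b \<sigma> y0 u Y \<longleftrightarrow>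
     (\<forall>t\<in>{0..T}. Y t \<in> borel_measurable (F t)) \<and>
     (AE \<omega> in M. continuous_on {0..T} (\<lambda>t. Y t \<omega>)) \<and>
     set_borel_measurable (lborel \<Otimes>\<^sub>M M) ({0..T} \<times> space M) (\<lambda>(t, \<omega>). Y t \<omega>) \<and>
     set_integrable (lborel \<Otimes>\<^sub>M M) ({0..T} \<times> space M) (\<lambda>(t, \<omega>). (Y t \<omega>)\<^sup>2) \<and>
     (AE \<omega> in M. set_integrable lborel {0..T} (\<lambda>s. b s (Y s \<omega>) (u s))) \<and>
     (\<exists>Z. is_ito_integral M F T W (\<lambda>t \<omega>. \<sigma> t (Y t \<omega>) (u t)) Z \<and>
        (\<forall>t\<in>{0..T}. AE \<omega> in M.
           Y t \<omega> = y0 + (LBINT s:{0..t}. b s (Y s \<omega>) (u s)) + Z t \<omega>))"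

text \<open>
  Elements of \<open>L\<^sup>2([0,T])\<close> are represented by Borel functions; only their values on \<open>[0,T]\<close> matter.
\<close>

definition L2 :: "real \<Rightarrow> (real \<Rightarrow> real) set" where
  "L2 T = {u. set_borel_measurable lborel {0..T} u \<and> set_integrable lborel {0..T} (\<lambda>t. (u t)\<^sup>2)}"

definition L2_inner :: "real \<Rightarrow> (real \<Rightarrow> real) \<Rightarrow> (real \<Rightarrow> real) \<Rightarrow> real" where
  "L2_inner T u v = (LBINT t:{0..T}. u t * v t)"

definition L2_norm :: "real \<Rightarrow> (real \<Rightarrow> real) \<Rightarrow> real" where
  "L2_norm T u = sqrt (L2_inner T u u)"

definition objective ::
    "'a measure \<Rightarrow> real \<Rightarrow> ((real \<Rightarrow> real) \<Rightarrow> real \<Rightarrow> 'a \<Rightarrow> real) \<Rightarrow>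
     (real \<Rightarrow> real) \<Rightarrow> (real \<Rightarrow> real) \<Rightarrow> (real \<Rightarrow> real) \<Rightarrow> (real \<Rightarrow> real) \<Rightarrow> real" where
  "objective M T y h j k u =
     (\<integral>\<omega>. ((LBINT t:{0..T}. h (y u t \<omega>) + j (u t)) + k (y u T \<omega>)) \<partial>M)"

definition has_L2_gradient :: "real \<Rightarrow> ((real \<Rightarrow> real) \<Rightarrow> real) \<Rightarrow> (real \<Rightarrow> real) \<Rightarrow> (real \<Rightarrow> real) \<Rightarrow> bool" where
  "has_L2_gradient T J g u \<longleftrightarrow> g \<in> L2 T \<and>
     (\<forall>\<epsilon>>0. \<exists>\<eta>>0. \<forall>v\<in>L2 T. L2_norm T v < \<eta> \<longrightarrow>
        \<bar>J (\<lambda>t. u t + v t) - J u - L2_inner T g v\<bar> \<le> \<epsilon> * L2_norm T v)"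

definition continuous_L2_gradient ::
    "real \<Rightarrow> ((real \<Rightarrow> real) \<Rightarrow> real) \<Rightarrow> ((real \<Rightarrow> real) \<Rightarrow> real \<Rightarrow> real) \<Rightarrow> bool" where
  "continuous_L2_gradient T J G \<longleftrightarrow>
     (\<forall>u\<in>L2 T. has_L2_gradient T J (G u) u) \<and>
     (\<forall>u\<in>L2 T. \<forall>\<epsilon>>0. \<exists>\<eta>>0. \<forall>v\<in>L2 T. L2_norm T (\<lambda>t. v t - u t) < \<eta> \<longrightarrow>
        L2_norm T (\<lambda>t. G v t - G u t) < \<epsilon>)"

definition admissible_controls ::
    "'a measure \<Rightarrow> real \<Rightarrow> ((real \<Rightarrow> real) \<Rightarrow> real \<Rightarrow> 'a \<Rightarrow> real) \<Rightarrow> real \<Rightarrow> (real \<Rightarrow> real) set" where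
  "admissible_controls M T y \<delta> =
     {u \<in> L2 T. (LBINT t:{0..T}. (\<integral>\<omega>. y u t \<omega> \<partial>M)) - \<delta> \<le> 0}"

text \<open>
  The projection is characterized by its variational inequality, which for convex \<open>K\<close> is
  equivalent to \<open>P w\<close> being the point of \<open>K\<close> nearest to \<open>w\<close>. It determines \<open>P w\<close> up to a null set.
\<close>

definition is_L2_projection ::
    "real \<Rightarrow> (real \<Rightarrow> real) set \<Rightarrow> ((real \<Rightarrow> real) \<Rightarrow> real \<Rightarrow> real) \<Rightarrow> bool" where
  "is_L2_projection T K P \<longleftrightarrow>
     (\<forall>w\<in>L2 T. P w \<in> K \<and>
        (\<forall>v\<in>K. L2_inner T (\<lambda>t. P w t - w t) (\<lambda>t. v t - P w t) \<ge> 0))"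

text \<open>
  \<open>-\<psi>' = 1 + \<psi> b\<^sub>y\<close>, \<open>\<psi>(T) = 0\<close>. Since \<open>b\<^sub>y\<close> is only bounded and measurable, the equation is read in
  the sense of Caratheodory, i.e. in integrated form.
\<close>

definition solves_dual :: "real \<Rightarrow> (real \<Rightarrow> real) \<Rightarrow> (real \<Rightarrow> real) \<Rightarrow> bool" where
  "solves_dual T b\<^sub>y \<psi> \<longleftrightarrow> continuous_on {0..T} \<psi> \<and>
     (\<forall>t\<in>{0..T}. \<psi> t = (LBINT s:{t..T}. 1 + \<psi> s * b\<^sub>y s))"

text \<open>
  By duality with \<open>\<psi>\<close>, the expected time integral of the state of a control \<open>v\<close> is
  \<open>\<psi>(0) y0 + \<integral> \<psi> (b\<^sub>u v + m) dt\<close>, so the admissible set is a half-space with normal \<open>\<psi> b\<^sub>u\<close>. With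
  \<open>w = u - \<rho> J'(u)\<close>, the multiplier is the positive part of the constraint violation of \<open>w\<close> divided
  by \<open>\<rho> \<parallel>\<psi> b\<^sub>u\<parallel>\<^sup>2\<close>. If \<open>\<psi> b\<^sub>u\<close> vanishes almost everywhere, the formula gives 0 (as \<open>x / 0 = 0\<close>); the
  admissible set is then empty or all of \<open>L\<^sup>2\<close>.
\<close>

definition explicit_multiplier ::
    "real \<Rightarrow> real \<Rightarrow> (real \<Rightarrow> real) \<Rightarrow> (real \<Rightarrow> real) \<Rightarrow> (real \<Rightarrow> real) \<Rightarrow> real \<Rightarrow> real \<Rightarrow>
     (real \<Rightarrow> real) \<Rightarrow> real" where
  "explicit_multiplier T y0 b\<^sub>u m \<psi> \<delta> \<rho> w =
     max 0 (\<psi> 0 * y0 + (LBINT t:{0..T}. \<psi> t * (b\<^sub>u t * w t + m t)) - \<delta>)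
       / (\<rho> * (LBINT t:{0..T}. (\<psi> t * b\<^sub>u t)\<^sup>2))"

end

theory Submission
  imports Defs
begin

text \<open>
  Two facts carry the proof. The first is that, although the state equation is stochastic with a
  possibly nonlinear diffusion coefficient, the constraint sees only the mean \<open>e(t) = E Y\<^sub>t\<close>: an Ito
  integral has mean zero (lemma \<open>ito_integral_mean_zero\<close>) and the drift is affine, so \<open>e\<close> solves the
  deterministic linear equation \<open>e(t) = y0 + \<integral>\<^sub>0\<^sup>t (b\<^sub>y e + b\<^sub>u v + m) ds\<close>
  (lemma \<open>state_mean_equation\<close>). Testing it against the dual function \<open>\<psi>\<close> eliminates \<open>e\<close> and gives
  \<open>\<integral>\<^sub>0\<^sup>T e dt = \<psi>(0) y0 + \<integral>\<^sub>0\<^sup>T \<psi> (b\<^sub>u v + m) dt\<close> (lemmas \<open>dual_representation\<close> and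
  \<open>mean_time_integral_of_state\<close>). Since \<open>b\<^sub>y\<close> is merely bounded and measurable, \<open>\<psi>\<close> and \<open>e\<close> need
  not be classically differentiable; integration by parts is therefore carried out as an exchange of
  the order of integration over a triangle.

  The admissible set is thus a closed half-space of \<open>L\<^sup>2\<close> with normal \<open>\<psi> b\<^sub>u\<close> (or all of \<open>L\<^sup>2\<close>, if the
  normal vanishes almost everywhere, since a projection onto it exists). The second fact
  is that the projection of \<open>w\<close> onto a half-space moves \<open>w\<close> along the normal by the constraint
  violation divided by the squared norm of the normal (lemma \<open>L2_projection_halfspace\<close>). Up to the
  factor \<open>\<rho>\<close> this step length is the multiplier, which is nonnegative because the violation enters
  through its positive part. The new control lies in the admissible set because it is a projection,
  and Fubini's theorem turns this into the asserted bound on the mean of the time integral.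
\<close>

section \<open>Square integrable functions and projection onto a half-space\<close>

lemma set_integrable_bounded_mult:
  fixes f g :: "real \<Rightarrow> real"
  assumes f: "set_borel_measurable lborel A f" and bd: "\<forall>x\<in>A. \<bar>f x\<bar> \<le> B"
    and g: "set_integrable lborel A g"
  shows "set_integrable lborel A (\<lambda>x. f x * g x)"
proof -
  have [measurable]: "(\<lambda>x. indicator A x * f x) \<in> borel_measurable lborel"
    using f by (simp add: set_borel_measurable_def)
  have gi: "integrable lborel (\<lambda>x. indicator A x * g x)"
    using g by (simp add: set_integrable_def)
  then have [measurable]: "(\<lambda>x. indicator A x * g x) \<in> borel_measurable lborel"
    by (rule borel_measurable_integrable)
  have "integrable lborel (\<lambda>x. (indicator A x * f x) * (indicator A x * g x))"
  proof (rule Bochner_Integration.integrable_bound)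
    show "integrable lborel (\<lambda>x. B * (indicator A x * g x))"
      using gi by simp
    show "AE x in lborel. norm ((indicator A x * f x) * (indicator A x * g x))
        \<le> norm (B * (indicator A x * g x))"
    proof (rule AE_I2)
      fix x :: real
      show "norm ((indicator A x * f x) * (indicator A x * g x)) \<le> norm (B * (indicator A x * g x))"
      proof (cases "x \<in> A")
        case True
        with bd have "\<bar>f x\<bar> \<le> \<bar>B\<bar>" by force
        with True show ?thesis by (simp add: abs_mult mult_right_mono)
      qed simp
    qed
  qed simp
  moreover have "(\<lambda>x. (indicator A x * f x) * (indicator A x * g x))
      = (\<lambda>x. indicator A x *\<^sub>R (f x * g x))"
    by (auto simp: fun_eq_iff indicator_def)
  ultimately show ?thesis by (simp add: set_integrable_def)
qed

lemma set_borel_measurable_mult: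
  fixes f g :: "real \<Rightarrow> real"
  assumes "set_borel_measurable lborel A f" "set_borel_measurable lborel A g"
  shows "set_borel_measurable lborel A (\<lambda>x. f x * g x)"
proof -
  have "(\<lambda>x. (indicator A x * f x) * (indicator A x * g x)) \<in> borel_measurable lborel"
    using assms by (auto simp: set_borel_measurable_def)
  moreover have "(\<lambda>x. (indicator A x * f x) * (indicator A x * g x))
      = (\<lambda>x. indicator A x *\<^sub>R (f x * g x))"
    by (auto simp: fun_eq_iff indicator_def)
  ultimately show ?thesis by (simp add: set_borel_measurable_def)
qed

lemma bounded_in_L2:
  assumes f: "set_borel_measurable lborel {0..T} f" and bd: "\<forall>t\<in>{0..T}. \<bar>f t\<bar> \<le> B"
  shows "f \<in> L2 T"
proof -
  have one: "set_integrable lborel {0..T} (\<lambda>t. 1::real)"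
    unfolding set_integrable_def by (rule borel_integrable_compact) auto
  have "set_integrable lborel {0..T} (\<lambda>t. f t * (f t * 1))"
    by (intro set_integrable_bounded_mult[OF f bd] one)
  with f show ?thesis by (simp add: L2_def power2_eq_square)
qed

lemma L2_mult_integrable:
  assumes "u \<in> L2 T" "v \<in> L2 T"
  shows "set_integrable lborel {0..T} (\<lambda>t. u t * v t)"
proof -
  let ?i = "indicator {0..T} :: real \<Rightarrow> real"
  have [measurable]: "(\<lambda>x. ?i x * u x) \<in> borel_measurable lborel"
    "(\<lambda>x. ?i x * v x) \<in> borel_measurable lborel"
    using assms by (auto simp: L2_def set_borel_measurable_def)
  have "integrable lborel (\<lambda>x. (?i x * u x) * (?i x * v x))"
  proof (rule Bochner_Integration.integrable_bound)
    show "integrable lborel (\<lambda>x. ?i x * (u x)\<^sup>2 + ?i x * (v x)\<^sup>2)"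
      using assms by (auto simp: L2_def set_integrable_def)
    show "AE x in lborel. norm ((?i x * u x) * (?i x * v x)) \<le> norm (?i x * (u x)\<^sup>2 + ?i x * (v x)\<^sup>2)"
    proof (rule AE_I2)
      fix x
      have "2 * \<bar>u x\<bar> * \<bar>v x\<bar> \<le> (u x)\<^sup>2 + (v x)\<^sup>2"
        using sum_squares_bound[of "\<bar>u x\<bar>" "\<bar>v x\<bar>"] by simp
      moreover have "0 \<le> \<bar>u x\<bar> * \<bar>v x\<bar>" by simp
      ultimately have "\<bar>u x * v x\<bar> \<le> (u x)\<^sup>2 + (v x)\<^sup>2"
        unfolding abs_mult by linarith
      then show "norm ((?i x * u x) * (?i x * v x)) \<le> norm (?i x * (u x)\<^sup>2 + ?i x * (v x)\<^sup>2)"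
        by (simp add: indicator_def)
    qed
  qed simp
  moreover have "(\<lambda>x. (?i x * u x) * (?i x * v x)) = (\<lambda>x. ?i x *\<^sub>R (u x * v x))"
    by (auto simp: fun_eq_iff indicator_def)
  ultimately show ?thesis by (simp add: set_integrable_def)
qed

lemma L2_integrable:
  assumes "u \<in> L2 T"
  shows "set_integrable lborel {0..T} u"
proof -
  have "set_borel_measurable lborel {0..T} (\<lambda>_. 1::real)"
    by (simp add: set_borel_measurable_def)
  then have "(\<lambda>_. 1) \<in> L2 T"
    by (rule bounded_in_L2[where B = 1]) simp
  from L2_mult_integrable[OF assms this] show ?thesis by simp
qed

lemma L2_diff_scaled:
  assumes u: "u \<in> L2 T" and v: "v \<in> L2 T"
  shows "(\<lambda>t. u t - c * v t) \<in> L2 T"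
proof -
  have "set_borel_measurable lborel {0..T} (\<lambda>t. u t - c * v t)"
  proof -
    have "(\<lambda>x. indicator {0..T} x * u x - c * (indicator {0..T} x * v x)) \<in> borel_measurable lborel"
      using assms by (auto simp: L2_def set_borel_measurable_def)
    moreover have "(\<lambda>x. indicator {0..T} x * u x - c * (indicator {0..T} x * v x))
        = (\<lambda>x. indicator {0..T} x *\<^sub>R (u x - c * v x))"
      by (auto simp: fun_eq_iff indicator_def)
    ultimately show ?thesis by (simp add: set_borel_measurable_def)
  qed
  moreover have "set_integrable lborel {0..T} (\<lambda>t. u t * u t - 2 * c * (u t * v t) + c\<^sup>2 * (v t * v t))"
    by (intro set_integral_add set_integral_diff set_integrable_mult_right L2_mult_integrable u v)
  moreover have "(\<lambda>t. u t * u t - 2 * c * (u t * v t) + c\<^sup>2 * (v t * v t)) = (\<lambda>t. (u t - c * v t)\<^sup>2)"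
    by (auto simp: fun_eq_iff power2_eq_square algebra_simps)
  ultimately show ?thesis by (simp add: L2_def)
qed

lemma L2_inner_diff_scaled:
  assumes "u \<in> L2 T" "v \<in> L2 T" "n \<in> L2 T"
  shows "L2_inner T n (\<lambda>t. u t - c * v t) = L2_inner T n u - c * L2_inner T n v"
proof -
  have "L2_inner T n (\<lambda>t. u t - c * v t) = (LBINT t:{0..T}. n t * u t - c * (n t * v t))"
    unfolding L2_inner_def by (intro arg_cong[where f="set_lebesgue_integral lborel {0..T}"])
      (auto simp: fun_eq_iff algebra_simps)
  also have "\<dots> = (LBINT t:{0..T}. n t * u t) - (LBINT t:{0..T}. c * (n t * v t))"
    by (intro set_integral_diff set_integrable_mult_right L2_mult_integrable assms)
  finally show ?thesis by (simp add: L2_inner_def)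
qed

lemma L2_inner_self_nonneg: "0 \<le> L2_inner T n n"
  unfolding L2_inner_def set_lebesgue_integral_def
  by (rule Bochner_Integration.integral_nonneg) (simp add: indicator_def)

lemma L2_inner_self_le_0_AE:
  assumes "n \<in> L2 T" "L2_inner T n n \<le> 0"
  shows "AE t in lborel. t \<in> {0..T} \<longrightarrow> n t = 0"
proof -
  have "integrable lborel (\<lambda>t. indicator {0..T} t *\<^sub>R (n t * n t))"
    using L2_mult_integrable[OF assms(1,1)] by (simp add: set_integrable_def)
  moreover have "AE t in lborel. 0 \<le> indicator {0..T} t *\<^sub>R (n t * n t)"
    by (simp add: indicator_def)
  moreover have "(\<integral>t. indicator {0..T} t *\<^sub>R (n t * n t) \<partial>lborel) = 0"
    using antisym[OF assms(2) L2_inner_self_nonneg]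
    unfolding L2_inner_def set_lebesgue_integral_def .
  ultimately have "AE t in lborel. indicator {0..T} t *\<^sub>R (n t * n t) = 0"
    using integral_nonneg_eq_0_iff_AE by blast
  then show ?thesis by eventually_elim auto
qed

lemma L2_inner_AE_0:
  assumes "AE t in lborel. t \<in> {0..T} \<longrightarrow> n t = 0"
  shows "L2_inner T n v = 0"
proof -
  have "AE t in lborel. indicator {0..T} t *\<^sub>R (n t * v t) = 0"
    using assms by eventually_elim (auto simp: indicator_def)
  then show ?thesis
    unfolding L2_inner_def set_lebesgue_integral_def by (rule integral_eq_zero_AE)
qed

lemma L2_inner_commute: "L2_inner T u v = L2_inner T v u"
  by (simp add: L2_inner_def mult.commute)

text \<open>
  Adding the two inequalities, each tested with the other candidate, bounds \<open>\<parallel>p - q\<parallel>\<^sup>2\<close> by 0. The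
  variational inequality thus characterizes a projection up to a null set, so it suffices to guess
  the projection and to check the inequality for the guess.
\<close>

lemma variational_inequality_unique:
  assumes p: "p \<in> L2 T" and q: "q \<in> L2 T" and w: "w \<in> L2 T"
    and pq: "0 \<le> L2_inner T (\<lambda>t. p t - w t) (\<lambda>t. q t - p t)"
    and qp: "0 \<le> L2_inner T (\<lambda>t. q t - w t) (\<lambda>t. p t - q t)"
  shows "AE t in lborel. t \<in> {0..T} \<longrightarrow> p t = q t"
proof -
  have L: "(\<lambda>t. u t - v t) \<in> L2 T" if "u \<in> L2 T" "v \<in> L2 T" for u v
    using L2_diff_scaled[OF that, of 1] by simp
  have D: "L2_inner T n (\<lambda>t. u t - v t) = L2_inner T n u - L2_inner T n v"
    if "u \<in> L2 T" "v \<in> L2 T" "n \<in> L2 T" for n u v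
    using L2_inner_diff_scaled[OF that, of 1] by simp
  have D': "L2_inner T (\<lambda>t. u t - v t) n = L2_inner T u n - L2_inner T v n"
    if "u \<in> L2 T" "v \<in> L2 T" "n \<in> L2 T" for n u v
    using D[OF that] by (simp add: L2_inner_commute)
  have "L2_inner T (\<lambda>t. p t - q t) (\<lambda>t. p t - q t) \<le> 0"
    using pq qp p q w by (simp add: D D' L L2_inner_commute[of T q p]
      L2_inner_commute[of T w p] L2_inner_commute[of T w q])
  from L2_inner_self_le_0_AE[OF L[OF p q] this] show ?thesis by simp
qed

text \<open>
  The candidate \<open>q = w - l n\<close> satisfies the constraint, with equality unless \<open>l = 0\<close>
  (complementary slackness). Hence \<open>(q - w, v - q) = l ((n, q) - (n, v))\<close> is nonnegative for
  feasible \<open>v\<close>, which is the variational inequality for \<open>q\<close>.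
\<close>

lemma L2_projection_halfspace:
  assumes n: "n \<in> L2 T" and w: "w \<in> L2 T"
    and K: "K = {v \<in> L2 T. a + L2_inner T n v \<le> \<delta>}"
    and pK: "p \<in> K"
    and p: "\<And>v. v \<in> K \<Longrightarrow> 0 \<le> L2_inner T (\<lambda>t. p t - w t) (\<lambda>t. v t - p t)"
  shows "AE t in lborel. t \<in> {0..T} \<longrightarrow>
    p t = w t - max 0 (a + L2_inner T n w - \<delta>) / L2_inner T n n * n t"
proof -
  define l where "l = max 0 (a + L2_inner T n w - \<delta>) / L2_inner T n n"
  define q where "q = (\<lambda>t. w t - l * n t)"
  have pL: "p \<in> L2 T" using pK K by simp
  have qL: "q \<in> L2 T" unfolding q_def by (rule L2_diff_scaled[OF w n])
  have l0: "0 \<le> l" unfolding l_def using L2_inner_self_nonneg[of T n] by simp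
  have nq: "L2_inner T n q = L2_inner T n w - l * L2_inner T n n"
    unfolding q_def by (rule L2_inner_diff_scaled[OF w n n])
  have feasible: "a + L2_inner T n q \<le> \<delta>" and active: "l = 0 \<or> a + L2_inner T n q = \<delta>"
  proof -
    have "a + L2_inner T n q \<le> \<delta> \<and> (l = 0 \<or> a + L2_inner T n q = \<delta>)"
    \<comment> \<open>For a normal that vanishes almost everywhere the constraint reads \<open>a \<le> \<delta>\<close> for every control.
      It holds because \<open>p\<close> satisfies it, so the violation is 0 and so is \<open>l\<close>.\<close>
    proof (cases "L2_inner T n n = 0")
      case True
      then have "AE t in lborel. t \<in> {0..T} \<longrightarrow> n t = 0"
        by (intro L2_inner_self_le_0_AE n) simp
      then have "L2_inner T n v = 0" for v by (rule L2_inner_AE_0)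
      with pK K True show ?thesis by (simp add: l_def)
    next
      case False
      then have "l * L2_inner T n n = max 0 (a + L2_inner T n w - \<delta>)"
        by (simp add: l_def)
      with nq show ?thesis by (auto simp: l_def max_def)
    qed
    then show "a + L2_inner T n q \<le> \<delta>" "l = 0 \<or> a + L2_inner T n q = \<delta>" by auto
  qed
  have "L2_inner T (\<lambda>t. q t - w t) (\<lambda>t. p t - q t) = - l * (L2_inner T n p - L2_inner T n q)"
  proof -
    have "L2_inner T (\<lambda>t. q t - w t) (\<lambda>t. p t - q t) = - l * L2_inner T n (\<lambda>t. p t - 1 * q t)"
      unfolding q_def L2_inner_def set_integral_mult_right[symmetric] by (simp add: algebra_simps)
    then show ?thesis by (simp only: L2_inner_diff_scaled[OF pL qL n]) simp
  qed
  also have "\<dots> \<ge> 0"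
    using active
  proof
    assume "a + L2_inner T n q = \<delta>"
    moreover have "a + L2_inner T n p \<le> \<delta>" using pK K by simp
    ultimately have "L2_inner T n p - L2_inner T n q \<le> 0" by simp
    with l0 show ?thesis by (simp add: mult_nonneg_nonpos)
  qed simp
  finally have qp: "0 \<le> L2_inner T (\<lambda>t. q t - w t) (\<lambda>t. p t - q t)" .
  have "q \<in> K" using qL feasible K by simp
  from variational_inequality_unique[OF pL qL w p[OF this] qp] show ?thesis
    by (simp add: q_def l_def)
qed

section \<open>Ito integrals have mean zero\<close>

text \<open>
  On a probability space \<open>(E Z)\<^sup>2 = (E (S\<^sub>N - Z))\<^sup>2 \<le> E (S\<^sub>N - Z)\<^sup>2\<close>, since a variance is nonnegative.
  Integrability of the limit comes from any member of the sequence at finite \<open>L\<^sup>2\<close> distance from it.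
\<close>

lemma (in prob_space) L2_limit_mean_zero:
  assumes S: "\<And>N. integrable M (S N)" and S0: "\<And>N. expectation (S N) = 0"
    and Z[measurable]: "Z \<in> borel_measurable M"
    and lim: "(\<lambda>N. \<integral>\<^sup>+\<omega>. ennreal ((S N \<omega> - Z \<omega>)\<^sup>2) \<partial>M) \<longlonglongrightarrow> 0"
  shows "integrable M Z" and "expectation Z = 0"
proof -
  have [measurable]: "S N \<in> borel_measurable M" for N using S by (rule borel_measurable_integrable)
  have sq: "integrable M (\<lambda>\<omega>. (S N \<omega> - Z \<omega>)\<^sup>2)"
    if "(\<integral>\<^sup>+\<omega>. ennreal ((S N \<omega> - Z \<omega>)\<^sup>2) \<partial>M) < \<infinity>" for N
    using that by (intro integrableI_nonneg) auto
  have "eventually (\<lambda>N. (\<integral>\<^sup>+\<omega>. ennreal ((S N \<omega> - Z \<omega>)\<^sup>2) \<partial>M) < 1) sequentially"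
    using lim by (rule order_tendstoD) simp
  then obtain N where "(\<integral>\<^sup>+\<omega>. ennreal ((S N \<omega> - Z \<omega>)\<^sup>2) \<partial>M) < 1"
    by (auto simp: eventually_sequentially)
  from less_trans[OF this ennreal_one_less_top]
  have "integrable M (\<lambda>\<omega>. (S N \<omega> - Z \<omega>)\<^sup>2)"
    by (intro sq) simp
  then have "integrable M (\<lambda>\<omega>. S N \<omega> - Z \<omega>)"
    by (rule square_integrable_imp_integrable[rotated]) measurable
  from Bochner_Integration.integrable_diff[OF S[of N] this] show Zi: "integrable M Z" by simp
  have "ennreal ((expectation Z)\<^sup>2) \<le> (\<integral>\<^sup>+\<omega>. ennreal ((S N \<omega> - Z \<omega>)\<^sup>2) \<partial>M)" for N
  proof (cases "(\<integral>\<^sup>+\<omega>. ennreal ((S N \<omega> - Z \<omega>)\<^sup>2) \<partial>M) < \<infinity>")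
    case True
    note I = sq[OF True]
    have Di: "integrable M (\<lambda>\<omega>. S N \<omega> - Z \<omega>)" using S Zi by simp
    have "expectation (\<lambda>\<omega>. S N \<omega> - Z \<omega>) = - expectation Z"
      using S Zi S0 by simp
    moreover have "0 \<le> variance (\<lambda>\<omega>. S N \<omega> - Z \<omega>)" by (rule variance_positive)
    ultimately have "(expectation Z)\<^sup>2 \<le> expectation (\<lambda>\<omega>. (S N \<omega> - Z \<omega>)\<^sup>2)"
      unfolding variance_eq[OF Di I] by simp
    then show ?thesis
      by (subst nn_integral_eq_integral[OF I]) (auto intro: ennreal_leI)
  qed (simp add: not_less top_unique)
  from LIMSEQ_le_const[OF lim, of "ennreal ((expectation Z)\<^sup>2)"] this
  have "ennreal ((expectation Z)\<^sup>2) \<le> 0" by blast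
  then show "expectation Z = 0" by (simp add: ennreal_eq_0_iff)
qed

lemma (in prob_space) sets_augmented_filtration:
  assumes W: "\<forall>s\<in>{0..t}. W s \<in> borel_measurable M"
  shows "sets (natural_filtration M W t) \<subseteq> sets M"
    and "sets (augmented_filtration M W t)
      = sigma_sets (space M) (sets (natural_filtration M W t) \<union> null_sets M)"
    and "sets (augmented_filtration M W t) \<subseteq> sets M"
    and "space (augmented_filtration M W t) = space M"
proof -
  let ?G = "{W s -` B \<inter> space M | s B. s \<in> {0..t} \<and> B \<in> sets borel}"
  have G: "?G \<subseteq> sets M" using W by (auto intro: measurable_sets)
  then show N: "sets (natural_filtration M W t) \<subseteq> sets M"
    unfolding natural_filtration_def by (subst sets_measure_of) (use sets.sigma_sets_subset[OF G] in auto)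
  have NM: "sets (natural_filtration M W t) \<union> null_sets M \<subseteq> sets M"
    using N by auto
  then show "sets (augmented_filtration M W t)
      = sigma_sets (space M) (sets (natural_filtration M W t) \<union> null_sets M)"
    unfolding augmented_filtration_def using sets.space_closed by (intro sets_measure_of) blast
  then show "sets (augmented_filtration M W t) \<subseteq> sets M"
    using sets.sigma_sets_subset[OF NM] by simp
  show "space (augmented_filtration M W t) = space M"
    unfolding augmented_filtration_def by (simp add: space_measure_of_conv)
qed

text \<open>
  Independence of the increment from the natural filtration extends to the augmented one: a null set
  is independent of everything, and the union of the natural sigma algebra with the null sets is
  closed under intersections, so independence passes to the sigma algebra that it generates.
\<close>

lemma (in prob_space) brownian_increment_indep:
  assumes W: "brownian_motion M T W" and st: "0 \<le> s" "s < t" "t \<le> T"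
    and \<xi>: "\<xi> \<in> borel_measurable (augmented_filtration M W s)"
  shows "indep_var borel \<xi> borel (\<lambda>\<omega>. W t \<omega> - W s \<omega>)"
proof -
  let ?N = "sets (natural_filtration M W s)"
  let ?X = "\<lambda>\<omega>. W t \<omega> - W s \<omega>"
  let ?P = "{?X -` B \<inter> space M | B. B \<in> sets borel}"
  have Wm: "W r \<in> borel_measurable M" if "r \<in> {0..T}" for r
    using W that by (auto simp: brownian_motion_def)
  then have [measurable]: "W t \<in> borel_measurable M" "W s \<in> borel_measurable M"
    using st by auto
  have Ws: "\<forall>r\<in>{0..s}. W r \<in> borel_measurable M"
    using st by (auto intro: Wm)
  note F = sets_augmented_filtration[of s W, OF Ws]
  have N: "indep_set ?N ?P"
    using W st by (simp add: brownian_motion_def)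
  have "indep_set (?N \<union> null_sets M) ?P"
  proof (rule indep_setI)
    show "?N \<union> null_sets M \<subseteq> events" using F(1) by auto
    show "?P \<subseteq> events" by auto
    fix a b assume a: "a \<in> ?N \<union> null_sets M" and b: "b \<in> ?P"
    show "prob (a \<inter> b) = prob a * prob b"
    proof (cases "a \<in> ?N")
      case True then show ?thesis using indep_setD[OF N _ b] by blast
    next
      case False
      then have a: "a \<in> null_sets M" using a by simp
      have "b \<in> events" using b by auto
      with a have "a \<inter> b \<in> null_sets M" by (simp add: null_set_Int2)
      with a show ?thesis by (simp add: measure_eq_0_null_sets)
    qed
  qed
  moreover have "Int_stable (?N \<union> null_sets M)"
  proof (rule Int_stableI)
    fix a b assume ab: "a \<in> ?N \<union> null_sets M" "b \<in> ?N \<union> null_sets M"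
    then have "a \<in> sets M" "b \<in> sets M" using F(1) by auto
    with ab show "a \<inter> b \<in> ?N \<union> null_sets M"
      by (auto intro: null_set_Int1 null_set_Int2)
  qed
  moreover have "Int_stable ?P"
  proof (rule Int_stableI, clarify)
    fix A B :: "real set" assume "A \<in> sets borel" "B \<in> sets borel"
    then show "\<exists>C. ?X -` A \<inter> space M \<inter> (?X -` B \<inter> space M) = ?X -` C \<inter> space M \<and> C \<in> sets borel"
      by (intro exI[of _ "A \<inter> B"]) auto
  qed
  ultimately have "indep_set (sigma_sets (space M) (?N \<union> null_sets M)) (sigma_sets (space M) ?P)"
    by (rule indep_set_sigma_sets)
  then have I: "indep_set (sets (augmented_filtration M W s)) (sigma_sets (space M) ?P)"
    by (simp add: F(2))
  have sub: "sigma_sets (space M) {\<xi> -` A \<inter> space M | A. A \<in> sets borel} \<subseteq> sets (augmented_filtration M W s)"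
  proof -
    have "{\<xi> -` A \<inter> space M | A. A \<in> sets borel} \<subseteq> sets (augmented_filtration M W s)"
      using measurable_sets[OF \<xi>] F(4) by auto
    from sets.sigma_sets_subset[OF this] show ?thesis by (simp add: F(4))
  qed
  have \<xi>M: "\<xi> \<in> borel_measurable M"
    using \<xi> F(3,4) by (auto simp: measurable_def)
  have "indep_set (sigma_sets (space M) {\<xi> -` A \<inter> space M | A. A \<in> sets borel}) (sigma_sets (space M) ?P)"
    using I unfolding indep_set_def by (rule indep_sets_mono_sets) (use sub in \<open>auto split: bool.split\<close>)
  with \<xi>M show ?thesis by (simp add: indep_var_eq)
qed

lemma (in prob_space) brownian_increment_mean:
  assumes W: "brownian_motion M T W" and st: "0 \<le> s" "s < t" "t \<le> T"
  shows "integrable M (\<lambda>\<omega>. W t \<omega> - W s \<omega>)" and "expectation (\<lambda>\<omega>. W t \<omega> - W s \<omega>) = 0"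
proof -
  have D: "distributed M lborel (\<lambda>\<omega>. W t \<omega> - W s \<omega>) (normal_density 0 (sqrt (t - s)))"
    using W st by (simp add: brownian_motion_def)
  have pos: "0 < sqrt (t - s)" using st by simp
  show "expectation (\<lambda>\<omega>. W t \<omega> - W s \<omega>) = 0"
    by (rule normal_distributed_expectation[OF pos D])
  have "integrable lborel (\<lambda>x. normal_density 0 (sqrt (t - s)) x * x)"
    by (rule integrable_normal_moment_nz_1[OF pos])
  then show "integrable M (\<lambda>\<omega>. W t \<omega> - W s \<omega>)"
    using distributed_integrable[OF D, of "\<lambda>x. x"] by simp
qed

text \<open>
  In each summand the coefficient is known when the increment starts, so the mean of the product is
  the product of the means, and the increment has mean 0.
\<close>

lemma (in prob_space) simple_integral_mean_zero:
  assumes W: "brownian_motion M T W" and t: "t \<in> {0..T}"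
    and simple: "simple_process M (augmented_filtration M W) T n \<tau> \<xi>"
  shows "integrable M (simple_integral W n \<tau> \<xi> t)"
    and "expectation (simple_integral W n \<tau> \<xi> t) = 0"
proof -
  have summand: "integrable M (\<lambda>\<omega>. \<xi> k \<omega> * (W (min t (\<tau> (Suc k))) \<omega> - W (min t (\<tau> k)) \<omega>)) \<and>
      expectation (\<lambda>\<omega>. \<xi> k \<omega> * (W (min t (\<tau> (Suc k))) \<omega> - W (min t (\<tau> k)) \<omega>)) = 0"
    if k: "k < n" for k
  proof (cases "\<tau> k < min t (\<tau> (Suc k))")
    case False
    \<comment> \<open>The interval is empty or starts after \<open>t\<close>, so the increment vanishes.\<close>
    then have "min t (\<tau> (Suc k)) = min t (\<tau> k)"
      using simple k unfolding simple_process_def by (smt (verit))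
    then show ?thesis by simp
  next
    case True
    let ?r = "min t (\<tau> (Suc k))"
    have \<tau>: "min t (\<tau> k) = \<tau> k" "0 \<le> \<tau> k" "?r \<le> T"
      using True t simple k by (auto simp: simple_process_def)
    have \<xi>: "\<xi> k \<in> borel_measurable (augmented_filtration M W (\<tau> k))"
      using simple k by (simp add: simple_process_def)
    obtain B where B: "\<And>\<omega>. \<omega> \<in> space M \<Longrightarrow> \<bar>\<xi> k \<omega>\<bar> \<le> B"
      using simple k unfolding simple_process_def by blast
    have I: "indep_var borel (\<xi> k) borel (\<lambda>\<omega>. W ?r \<omega> - W (\<tau> k) \<omega>)"
      by (rule brownian_increment_indep[OF W \<tau>(2) True \<tau>(3) \<xi>])
    have "integrable M (\<xi> k)"
      using B indep_var_rv1[OF I] by (intro integrable_const_bound[of _ B]) auto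
    then show ?thesis
      using indep_var_lebesgue_integral[OF I] indep_var_integrable[OF I]
        brownian_increment_mean[OF W \<tau>(2) True \<tau>(3)]
      by (simp add: \<tau>(1))
  qed
  then show "integrable M (simple_integral W n \<tau> \<xi> t)"
    unfolding simple_integral_def by (intro Bochner_Integration.integrable_sum) auto
  from summand show "expectation (simple_integral W n \<tau> \<xi> t) = 0"
    unfolding simple_integral_def by (subst Bochner_Integration.integral_sum) auto
qed

lemma (in prob_space) ito_integral_mean_zero:
  assumes W: "brownian_motion M T W" and t: "t \<in> {0..T}"
    and Z: "is_ito_integral M (augmented_filtration M W) T W \<phi> Z"
  shows "integrable M (Z t)" and "expectation (Z t) = 0"
proof -
  obtain n \<tau> \<xi> where simple: "\<And>N. simple_process M (augmented_filtration M W) T (n N) (\<tau> N) (\<xi> N)"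
    and lim: "(\<lambda>N. \<integral>\<^sup>+\<omega>. ennreal ((simple_integral W (n N) (\<tau> N) (\<xi> N) t \<omega> - Z t \<omega>)\<^sup>2) \<partial>M)
      \<longlonglongrightarrow> 0"
    using Z t unfolding is_ito_integral_def by blast
  have Zm: "Z t \<in> borel_measurable M" using Z t by (simp add: is_ito_integral_def)
  note S = simple_integral_mean_zero[OF W t simple]
  show "integrable M (Z t)" "expectation (Z t) = 0"
    by (rule L2_limit_mean_zero[OF S Zm lim])+
qed

section \<open>The equation for the mean of the state\<close>

text \<open>
  Fubini's theorem for the state, weighted by a bounded coefficient. Joint integrability follows from
  joint square integrability through \<open>\<bar>Y\<bar> \<le> 1 + Y\<^sup>2\<close>, as \<open>[0,T] \<times> \<Omega>\<close> has finite measure. The weight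
  \<open>b\<^sub>y\<close> serves the state equation, the weight 1 the constraint.
\<close>

lemma (in prob_space) time_expectation_Fubini:
  fixes Y :: "real \<Rightarrow> 'a \<Rightarrow> real" and c :: "real \<Rightarrow> real"
  assumes Ym: "set_borel_measurable (lborel \<Otimes>\<^sub>M M) ({0..T} \<times> space M) (\<lambda>(t, \<omega>). Y t \<omega>)"
    and Y2: "set_integrable (lborel \<Otimes>\<^sub>M M) ({0..T} \<times> space M) (\<lambda>(t, \<omega>). (Y t \<omega>)\<^sup>2)"
    and c: "set_borel_measurable lborel {0..T} c" and cB: "\<forall>t\<in>{0..T}. \<bar>c t\<bar> \<le> B"
    and t: "t \<in> {0..T}"
  shows "AE \<omega> in M. set_integrable lborel {0..t} (\<lambda>s. c s * Y s \<omega>)"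
    and "integrable M (\<lambda>\<omega>. LBINT s:{0..t}. c s * Y s \<omega>)"
    and "set_integrable lborel {0..t} (\<lambda>s. c s * expectation (Y s))"
    and "expectation (\<lambda>\<omega>. LBINT s:{0..t}. c s * Y s \<omega>) = (LBINT s:{0..t}. c s * expectation (Y s))"
proof -
  interpret PS: pair_sigma_finite lborel M
    by (intro pair_sigma_finite.intro sigma_finite_measure_axioms lborel.sigma_finite_measure_axioms)
  let ?P = "lborel \<Otimes>\<^sub>M M"
  let ?A = "{0..T} \<times> space M"
  let ?f = "\<lambda>z. indicator ?A z *\<^sub>R (case z of (t, \<omega>) \<Rightarrow> Y t \<omega>)"
  define g where "g s \<omega> = indicator {0..t} s *\<^sub>R (c s * Y s \<omega>)" for s \<omega>
  have A[measurable]: "?A \<in> sets ?P" by auto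
  have fm[measurable]: "?f \<in> borel_measurable ?P"
    using Ym by (simp add: set_borel_measurable_def)
  have cm[measurable]: "(\<lambda>s. indicator {0..T} s * c s) \<in> borel_measurable lborel"
    using c by (simp add: set_borel_measurable_def)
  have "emeasure ?P ?A = emeasure lborel {0..T} * emeasure M (space M)"
    by (rule emeasure_pair_measure_Times) auto
  then have "emeasure ?P ?A < \<infinity>"
    by (simp add: emeasure_space_1 emeasure_lborel_Icc_eq)
  then have one: "integrable ?P (indicator ?A :: _ \<Rightarrow> real)"
    using A by (simp add: integrable_indicator_iff)
  have "integrable ?P (\<lambda>z. \<bar>B\<bar> * ((indicator ?A z) + indicator ?A z *\<^sub>R (case z of (t, \<omega>) \<Rightarrow> (Y t \<omega>)\<^sup>2)))"
    using one Y2 unfolding set_integrable_def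
    by (intro integrable_mult_right Bochner_Integration.integrable_add)
  then have "integrable ?P (\<lambda>z. indicator {0..t} (fst z) * ((indicator {0..T} (fst z) * c (fst z)) * ?f z))"
  proof (rule Bochner_Integration.integrable_bound)
    show "(\<lambda>z. indicator {0..t} (fst z) * ((indicator {0..T} (fst z) * c (fst z)) * ?f z)) \<in> borel_measurable ?P"
      by (intro borel_measurable_times fm measurable_compose[OF measurable_fst cm]
          measurable_compose[OF measurable_fst borel_measurable_indicator]) auto
    show "AE z in ?P. norm (indicator {0..t} (fst z) * ((indicator {0..T} (fst z) * c (fst z)) * ?f z))
      \<le> norm (\<bar>B\<bar> * ((indicator ?A z) + indicator ?A z *\<^sub>R (case z of (t, \<omega>) \<Rightarrow> (Y t \<omega>)\<^sup>2)))"
    proof (rule AE_I2)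
      fix z :: "real \<times> 'a"
      obtain s \<omega> where z: "z = (s, \<omega>)" by force
      show "norm (indicator {0..t} (fst z) * ((indicator {0..T} (fst z) * c (fst z)) * ?f z))
        \<le> norm (\<bar>B\<bar> * ((indicator ?A z) + indicator ?A z *\<^sub>R (case z of (t, \<omega>) \<Rightarrow> (Y t \<omega>)\<^sup>2)))"
      proof (cases "s \<in> {0..t} \<and> (s, \<omega>) \<in> ?A")
        case True
        then have c: "\<bar>c s\<bar> \<le> \<bar>B\<bar>" using cB by force
        have y: "\<bar>Y s \<omega>\<bar> \<le> 1 + (Y s \<omega>)\<^sup>2"
          using sum_squares_bound[of 1 "\<bar>Y s \<omega>\<bar>"] by simp
        have "\<bar>c s\<bar> * \<bar>Y s \<omega>\<bar> \<le> \<bar>B\<bar> * (1 + (Y s \<omega>)\<^sup>2)"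
          using c y by (intro mult_mono) auto
        with True show ?thesis by (simp add: z abs_mult)
      qed (auto simp: z)
    qed
  qed
  moreover have "indicator {0..t} (fst z) * ((indicator {0..T} (fst z) * c (fst z)) * ?f z) = case_prod g z"
    if "z \<in> space ?P" for z
    using that t by (auto simp: g_def space_pair_measure indicator_def split: prod.splits)
  ultimately have gi: "integrable ?P (case_prod g)"
    by (simp cong: Bochner_Integration.integrable_cong)
  show "AE \<omega> in M. set_integrable lborel {0..t} (\<lambda>s. c s * Y s \<omega>)"
    using PS.AE_integrable_snd[OF gi] by (simp add: g_def set_integrable_def)
  show "integrable M (\<lambda>\<omega>. LBINT s:{0..t}. c s * Y s \<omega>)"
    using PS.integrable_snd[OF gi] by (simp add: g_def set_lebesgue_integral_def)
  have mean: "(\<integral>\<omega>. g s \<omega> \<partial>M) = indicator {0..t} s *\<^sub>R (c s * expectation (Y s))" for s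
    by (simp add: g_def)
  show "set_integrable lborel {0..t} (\<lambda>s. c s * expectation (Y s))"
    using PS.integrable_fst[OF gi] by (simp only: mean set_integrable_def)
  show "expectation (\<lambda>\<omega>. LBINT s:{0..t}. c s * Y s \<omega>) = (LBINT s:{0..t}. c s * expectation (Y s))"
    using PS.Fubini_integral[OF gi] unfolding mean by (simp only: g_def set_lebesgue_integral_def)
qed

lemma set_integrable_Icc_subset:
  fixes f :: "real \<Rightarrow> real"
  assumes "set_integrable lborel {a..b} f" "a \<le> c" "d \<le> b"
  shows "set_integrable lborel {c..d} f"
  by (rule set_integrable_subset[OF assms(1)]) (use assms in auto)

text \<open>
  Taking expectations in the state equation removes the Ito integral, and the affine drift commutes
  with the expectation. The source term \<open>b\<^sub>u v + m\<close> is integrable since it is the difference of the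
  drift along almost any path and \<open>b\<^sub>y Y\<close> along that path, both of which are integrable in time; as
  the source term is deterministic, a single path suffices.
\<close>

lemma (in prob_space) state_mean_equation:
  assumes W: "brownian_motion M T W" and T: "0 \<le> T"
    and Y: "is_state M (augmented_filtration M W) T W (drift b\<^sub>y b\<^sub>u m) \<sigma> y0 v Y"
    and by_meas: "set_borel_measurable lborel {0..T} b\<^sub>y"
    and by_bound: "\<forall>t\<in>{0..T}. \<bar>b\<^sub>y t\<bar> \<le> B"
  shows "set_integrable lborel {0..T} (\<lambda>t. b\<^sub>u t * v t + m t)"
    and "\<And>t. t \<in> {0..T} \<Longrightarrow> expectation (Y t)
      = y0 + (LBINT s:{0..t}. b\<^sub>y s * expectation (Y s) + (b\<^sub>u s * v s + m s))"
proof -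
  have Ym: "set_borel_measurable (lborel \<Otimes>\<^sub>M M) ({0..T} \<times> space M) (\<lambda>(t, \<omega>). Y t \<omega>)"
    and Y2: "set_integrable (lborel \<Otimes>\<^sub>M M) ({0..T} \<times> space M) (\<lambda>(t, \<omega>). (Y t \<omega>)\<^sup>2)"
    and drift_int: "AE \<omega> in M. set_integrable lborel {0..T} (\<lambda>s. drift b\<^sub>y b\<^sub>u m s (Y s \<omega>) (v s))"
    using Y by (auto simp: is_state_def)
  obtain Z where Z: "is_ito_integral M (augmented_filtration M W) T W (\<lambda>t \<omega>. \<sigma> t (Y t \<omega>) (v t)) Z"
    and eq: "\<And>t. t \<in> {0..T} \<Longrightarrow> AE \<omega> in M.
      Y t \<omega> = y0 + (LBINT s:{0..t}. drift b\<^sub>y b\<^sub>u m s (Y s \<omega>) (v s)) + Z t \<omega>"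
    using Y unfolding is_state_def by blast
  note F = time_expectation_Fubini[OF Ym Y2 by_meas by_bound]
  define r where "r = (\<lambda>t. b\<^sub>u t * v t + m t)"
  have drift: "drift b\<^sub>y b\<^sub>u m s x (v s) = b\<^sub>y s * x + r s" for s x
    by (simp add: drift_def r_def)
  have "T \<in> {0..T}" using T by simp
  from drift_int F(1)[OF this] have "AE \<omega> in M. set_integrable lborel {0..T} r"
  proof eventually_elim
    fix \<omega>
    assume "set_integrable lborel {0..T} (\<lambda>s. drift b\<^sub>y b\<^sub>u m s (Y s \<omega>) (v s))"
      and "set_integrable lborel {0..T} (\<lambda>s. b\<^sub>y s * Y s \<omega>)"
    from set_integral_diff(1)[OF this] show "set_integrable lborel {0..T} r"
      by (simp add: drift)
  qed
  then have r: "set_integrable lborel {0..T} r" by simp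
  then show "set_integrable lborel {0..T} (\<lambda>t. b\<^sub>u t * v t + m t)" by (simp add: r_def)
  fix t assume t: "t \<in> {0..T}"
  have rt: "set_integrable lborel {0..t} r"
    by (rule set_integrable_Icc_subset[OF r]) (use t in auto)
  note Ft = F[OF t]
  note Zt = ito_integral_mean_zero[OF W t Z]
  have Yt: "Y t \<in> borel_measurable M"
  proof -
    have "\<forall>s\<in>{0..t}. W s \<in> borel_measurable M"
      using W t by (auto simp: brownian_motion_def)
    note G = sets_augmented_filtration(3,4)[of t W, OF this]
    have "Y t \<in> borel_measurable (augmented_filtration M W t)"
      using Y t by (simp add: is_state_def)
    with G show ?thesis by (auto simp: measurable_def)
  qed
  have "AE \<omega> in M. Y t \<omega> = y0 + ((LBINT s:{0..t}. b\<^sub>y s * Y s \<omega>) + (LBINT s:{0..t}. r s)) + Z t \<omega>"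
    using eq[OF t] Ft(1) by eventually_elim (simp add: drift set_integral_add(2)[OF _ rt])
  then have "expectation (Y t) = expectation (\<lambda>\<omega>. y0 + ((LBINT s:{0..t}. b\<^sub>y s * Y s \<omega>)
      + (LBINT s:{0..t}. r s)) + Z t \<omega>)"
    using borel_measurable_integrable[OF Zt(1)] borel_measurable_integrable[OF Ft(2)] Yt
    by (intro integral_cong_AE) auto
  also have "\<dots> = y0 + (expectation (\<lambda>\<omega>. LBINT s:{0..t}. b\<^sub>y s * Y s \<omega>) + (LBINT s:{0..t}. r s))"
    using Zt Ft(2) by (simp add: prob_space)
  also have "\<dots> = y0 + (LBINT s:{0..t}. b\<^sub>y s * expectation (Y s) + r s)"
    by (simp add: Ft(4) set_integral_add(2)[OF Ft(3) rt])
  finally show "expectation (Y t)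
      = y0 + (LBINT s:{0..t}. b\<^sub>y s * expectation (Y s) + (b\<^sub>u s * v s + m s))"
    by (simp add: r_def)
qed

section \<open>Duality with the adjoint equation\<close>

text \<open>
  Both sides are the integral of \<open>g(t) p(s)\<close> over the triangle \<open>a \<le> t \<le> s \<le> b\<close>. This is integration
  by parts for a product of absolutely continuous functions, one vanishing at \<open>a\<close> and the other at \<open>b\<close>.
\<close>

lemma LBINT_triangle_swap:
  fixes g p :: "real \<Rightarrow> real"
  assumes g: "set_integrable lborel {a..b} g" and p: "set_integrable lborel {a..b} p"
  shows "(LBINT t:{a..b}. g t * (LBINT s:{t..b}. p s)) = (LBINT s:{a..b}. p s * (LBINT t:{a..s}. g t))"
proof -
  let ?P = "lborel \<Otimes>\<^sub>M lborel :: (real \<times> real) measure"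
  define G where "G = (\<lambda>t. indicator {a..b} t *\<^sub>R g t)"
  define Q where "Q = (\<lambda>t. indicator {a..b} t *\<^sub>R p t)"
  define f where "f t s = indicator {z. fst z \<le> snd z} (t, s) * (G t * Q s)" for t s :: real
  have Gi: "integrable lborel G" and Qi: "integrable lborel Q"
    using g p by (auto simp: G_def Q_def set_integrable_def)
  note [measurable] = borel_measurable_integrable[OF Gi] borel_measurable_integrable[OF Qi]
  have prod: "integrable ?P (\<lambda>z. G (fst z) * Q (snd z))"
  proof (rule lborel_pair.Fubini_integrable)
    show "integrable lborel (\<lambda>x. \<integral>y. norm (G (fst (x, y)) * Q (snd (x, y))) \<partial>lborel)"
      using integrable_norm[OF Gi] by (simp add: abs_mult)
    show "AE x in lborel. integrable lborel (\<lambda>y. G (fst (x, y)) * Q (snd (x, y)))"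
      using Qi by simp
  qed measurable
  have fi: "integrable ?P (case_prod f)"
  proof (rule Bochner_Integration.integrable_bound[OF prod])
    show "case_prod f \<in> borel_measurable ?P"
      unfolding f_def by measurable
    show "AE z in ?P. norm (case_prod f z) \<le> norm (G (fst z) * Q (snd z))"
      by (auto simp: f_def indicator_def)
  qed
  have inner1: "(\<integral>s. f t s \<partial>lborel) = indicator {a..b} t *\<^sub>R (g t * (LBINT s:{t..b}. p s))" for t
  proof -
    have "f t = (\<lambda>s. (indicator {a..b} t * g t) * (indicator {t..b} s *\<^sub>R p s))"
      by (auto simp: f_def G_def Q_def indicator_def fun_eq_iff)
    then show ?thesis by (simp add: set_lebesgue_integral_def)
  qed
  have inner2: "(\<integral>t. f t s \<partial>lborel) = indicator {a..b} s *\<^sub>R (p s * (LBINT t:{a..s}. g t))" for s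
  proof -
    have "(\<lambda>t. f t s) = (\<lambda>t. (indicator {a..b} s * p s) * (indicator {a..s} t *\<^sub>R g t))"
      by (auto simp: f_def G_def Q_def indicator_def fun_eq_iff)
    then show ?thesis by (simp add: set_lebesgue_integral_def)
  qed
  show ?thesis
    using lborel_pair.Fubini_integral[OF fi] unfolding inner1 inner2 by (simp add: set_lebesgue_integral_def)
qed

lemma dual_measurable_bounded:
  assumes "solves_dual T b\<^sub>y \<psi>"
  shows "set_borel_measurable lborel {0..T} \<psi>" and "\<exists>B. \<forall>t\<in>{0..T}. \<bar>\<psi> t\<bar> \<le> B"
proof -
  have c: "continuous_on {0..T} \<psi>" using assms by (simp add: solves_dual_def)
  then show "set_borel_measurable lborel {0..T} \<psi>"
    unfolding set_borel_measurable_def using borel_measurable_continuous_on_indicator[of "{0..T}" \<psi>] by simp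
  have "bounded (\<psi> ` {0..T})"
    by (intro compact_imp_bounded compact_continuous_image c) simp
  then show "\<exists>B. \<forall>t\<in>{0..T}. \<bar>\<psi> t\<bar> \<le> B"
    by (auto simp: bounded_iff)
qed

text \<open>
  With \<open>g = b\<^sub>y e + r\<close>, the density of \<open>e - e0\<close>, and \<open>p = 1 + \<psi> b\<^sub>y\<close>, the density of \<open>-\<psi>\<close>, exchanging
  the order of integration yields \<open>\<integral> \<psi> g = \<integral> p (e - e0)\<close>. The terms \<open>\<psi> b\<^sub>y e\<close> on the two sides cancel,
  and \<open>\<integral> p = \<psi>(0)\<close>.
\<close>

lemma dual_representation:
  assumes T: "0 \<le> T" and \<psi>: "solves_dual T b\<^sub>y \<psi>"
    and by_meas: "set_borel_measurable lborel {0..T} b\<^sub>y"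
    and by_bound: "\<forall>t\<in>{0..T}. \<bar>b\<^sub>y t\<bar> \<le> B"
    and e: "set_integrable lborel {0..T} e" and r: "set_integrable lborel {0..T} r"
    and eq: "\<And>t. t \<in> {0..T} \<Longrightarrow> e t = e0 + (LBINT s:{0..t}. b\<^sub>y s * e s + r s)"
  shows "(LBINT t:{0..T}. e t) = \<psi> 0 * e0 + (LBINT t:{0..T}. \<psi> t * r t)"
proof -
  obtain B' where B': "\<forall>t\<in>{0..T}. \<bar>\<psi> t\<bar> \<le> B'"
    using dual_measurable_bounded(2)[OF \<psi>] by blast
  note mult_\<psi> = set_integrable_bounded_mult[OF dual_measurable_bounded(1)[OF \<psi>] B']
  note mult_by = set_integrable_bounded_mult[OF by_meas by_bound]
  define p where "p = (\<lambda>s. 1 + \<psi> s * b\<^sub>y s)"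
  define g where "g = (\<lambda>s. b\<^sub>y s * e s + r s)"
  have one: "set_integrable lborel {0..T} (\<lambda>t. 1::real)"
    unfolding set_integrable_def by (rule borel_integrable_compact) auto
  have p: "set_integrable lborel {0..T} p"
    unfolding p_def using mult_\<psi>[OF mult_by[OF one]] one by (intro set_integral_add) auto
  have g: "set_integrable lborel {0..T} g"
    unfolding g_def using mult_by[OF e] r by (intro set_integral_add) auto
  have \<psi>eq: "\<psi> t = (LBINT s:{t..T}. p s)" if "t \<in> {0..T}" for t
    using \<psi> that by (simp add: solves_dual_def p_def)
  have \<psi>r: "set_integrable lborel {0..T} (\<lambda>t. \<psi> t * r t)" by (rule mult_\<psi>[OF r])
  have \<psi>be: "set_integrable lborel {0..T} (\<lambda>t. \<psi> t * (b\<^sub>y t * e t))" by (rule mult_\<psi>[OF mult_by[OF e]])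
  have "(LBINT t:{0..T}. \<psi> t * (b\<^sub>y t * e t)) + (LBINT t:{0..T}. \<psi> t * r t)
      = (LBINT t:{0..T}. \<psi> t * (b\<^sub>y t * e t) + \<psi> t * r t)"
    by (rule set_integral_add(2)[symmetric, OF \<psi>be \<psi>r])
  also have "\<dots> = (LBINT t:{0..T}. g t * (LBINT s:{t..T}. p s))"
    by (rule set_lebesgue_integral_cong) (auto simp: g_def algebra_simps simp flip: \<psi>eq)
  also have "\<dots> = (LBINT s:{0..T}. p s * (LBINT t:{0..s}. g t))"
    by (rule LBINT_triangle_swap[OF g p])
  also have "\<dots> = (LBINT s:{0..T}. e s + \<psi> s * (b\<^sub>y s * e s) - e0 * p s)"
  proof (rule set_lebesgue_integral_cong)
    show "\<forall>s. s \<in> {0..T} \<longrightarrow> p s * (LBINT t:{0..s}. g t) = e s + \<psi> s * (b\<^sub>y s * e s) - e0 * p s"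
    proof (intro allI impI)
      fix s assume "s \<in> {0..T}"
      then have I: "(LBINT t:{0..s}. g t) = e s - e0" using eq[of s] by (simp add: g_def)
      show "p s * (LBINT t:{0..s}. g t) = e s + \<psi> s * (b\<^sub>y s * e s) - e0 * p s"
        unfolding I by (simp add: p_def algebra_simps)
    qed
  qed simp
  also have "\<dots> = (LBINT s:{0..T}. e s) + (LBINT s:{0..T}. \<psi> s * (b\<^sub>y s * e s)) - e0 * \<psi> 0"
    using T by (simp add: set_integral_diff(2) set_integral_add e \<psi>be p \<psi>eq)
  finally show ?thesis by (simp add: mult.commute)
qed

text \<open>
  The two ways of writing the constraint functional agree, and as a function of the control \<open>v\<close> it is
  affine with linear part \<open>(\<psi> b\<^sub>u, v)\<close>. This is where the half-space comes from.
\<close>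

lemma (in prob_space) mean_time_integral_of_state:
  assumes W: "brownian_motion M T W" and T: "0 \<le> T"
    and Y: "is_state M (augmented_filtration M W) T W (drift b\<^sub>y b\<^sub>u m) \<sigma> y0 v Y"
    and by_meas: "set_borel_measurable lborel {0..T} b\<^sub>y"
    and by_bound: "\<forall>t\<in>{0..T}. \<bar>b\<^sub>y t\<bar> \<le> B"
    and \<psi>: "solves_dual T b\<^sub>y \<psi>"
  shows "expectation (\<lambda>\<omega>. LBINT t:{0..T}. Y t \<omega>) = (LBINT t:{0..T}. expectation (Y t))"
    and "(LBINT t:{0..T}. expectation (Y t)) = \<psi> 0 * y0 + (LBINT t:{0..T}. \<psi> t * (b\<^sub>u t * v t + m t))"
proof -
  have Ym: "set_borel_measurable (lborel \<Otimes>\<^sub>M M) ({0..T} \<times> space M) (\<lambda>(t, \<omega>). Y t \<omega>)"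
    and Y2: "set_integrable (lborel \<Otimes>\<^sub>M M) ({0..T} \<times> space M) (\<lambda>(t, \<omega>). (Y t \<omega>)\<^sup>2)"
    using Y by (auto simp: is_state_def)
  have "set_borel_measurable lborel {0..T} (\<lambda>_. 1::real)"
    by (simp add: set_borel_measurable_def)
  note F = time_expectation_Fubini[OF Ym Y2 this, of 1 T]
  show "expectation (\<lambda>\<omega>. LBINT t:{0..T}. Y t \<omega>) = (LBINT t:{0..T}. expectation (Y t))"
    using F(4) T by simp
  have e: "set_integrable lborel {0..T} (\<lambda>t. expectation (Y t))"
    using F(3) T by simp
  note E = state_mean_equation[OF W T Y by_meas by_bound]
  show "(LBINT t:{0..T}. expectation (Y t)) = \<psi> 0 * y0 + (LBINT t:{0..T}. \<psi> t * (b\<^sub>u t * v t + m t))"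
    by (rule dual_representation[OF T \<psi> by_meas by_bound e E(1) E(2)])
qed

section \<open>The projected gradient step\<close>

theorem theorem3p1:
  fixes M :: "'a measure" and W :: "real \<Rightarrow> 'a \<Rightarrow> real" and F :: "real \<Rightarrow> 'a measure"
    and T y0 \<delta> \<rho> C\<^sub>b C\<^sub>\<sigma> C :: real
    and b\<^sub>y b\<^sub>u m h h' j j' k k' \<psi> :: "real \<Rightarrow> real"
    and \<sigma> \<sigma>\<^sub>y \<sigma>\<^sub>u :: "real \<Rightarrow> real \<Rightarrow> real \<Rightarrow> real"
    and y :: "(real \<Rightarrow> real) \<Rightarrow> real \<Rightarrow> 'a \<Rightarrow> real"
    and J' P :: "(real \<Rightarrow> real) \<Rightarrow> real \<Rightarrow> real"
    and u :: "nat \<Rightarrow> real \<Rightarrow> real" and i :: nat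
  assumes "0 < T"
    and "prob_space M" and "complete_measure M"
    and "brownian_motion M T W" and "F = augmented_filtration M W"
    \<comment> \<open>coefficients of the state equation\<close>
    and "0 < C\<^sub>b" and "0 < C\<^sub>\<sigma>"
    and "set_borel_measurable lborel {0..T} b\<^sub>y" and "set_borel_measurable lborel {0..T} b\<^sub>u"
    and "\<And>t. t \<in> {0..T} \<Longrightarrow> \<bar>b\<^sub>y t\<bar> + \<bar>b\<^sub>u t\<bar> \<le> C\<^sub>b"
    and "\<And>x v. set_borel_measurable lborel {0..T} (\<lambda>t. \<sigma> t x v)"
    and "\<And>t x v. t \<in> {0..T} \<Longrightarrow> ((\<lambda>x. \<sigma> t x v) has_real_derivative \<sigma>\<^sub>y t x v) (at x)"
    and "\<And>t x v. t \<in> {0..T} \<Longrightarrow> ((\<lambda>v. \<sigma> t x v) has_real_derivative \<sigma>\<^sub>u t x v) (at v)"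
    and "\<And>t. t \<in> {0..T} \<Longrightarrow> continuous_on UNIV (\<lambda>(x, v). \<sigma>\<^sub>y t x v)"
    and "\<And>t. t \<in> {0..T} \<Longrightarrow> continuous_on UNIV (\<lambda>(x, v). \<sigma>\<^sub>u t x v)"
    and "\<And>t x v. t \<in> {0..T} \<Longrightarrow> \<bar>\<sigma>\<^sub>y t x v\<bar> + \<bar>\<sigma>\<^sub>u t x v\<bar> \<le> C\<^sub>\<sigma>"
    \<comment> \<open>cost functions\<close>
    and "\<And>x. (h has_real_derivative h' x) (at x)" and "continuous_on UNIV h'"
    and "\<And>x. (j has_real_derivative j' x) (at x)" and "continuous_on UNIV j'"
    and "\<And>x. (k has_real_derivative k' x) (at x)" and "continuous_on UNIV k'"
    and "\<And>x. \<bar>h' x\<bar> \<le> C * (1 + \<bar>x\<bar>)" and "\<And>x. \<bar>j' x\<bar> \<le> C * (1 + \<bar>x\<bar>)"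
    and "\<And>x. \<bar>k' x\<bar> \<le> C * (1 + \<bar>x\<bar>)"
    \<comment> \<open>states, gradient, projection and dual function\<close>
    and "\<And>v. v \<in> L2 T \<Longrightarrow> is_state M F T W (drift b\<^sub>y b\<^sub>u m) \<sigma> y0 v (y v)"
    and "continuous_L2_gradient T (objective M T y h j k) J'"
    and "is_L2_projection T (admissible_controls M T y \<delta>) P"
    and "solves_dual T b\<^sub>y \<psi>"
    \<comment> \<open>one step of the scheme\<close>
    and "0 < \<rho>" and "u i \<in> L2 T"
    and "u (Suc i) = P (\<lambda>t. u i t - \<rho> * J' (u i) t)"
  shows "\<exists>\<mu>. \<mu> = explicit_multiplier T y0 b\<^sub>u m \<psi> \<delta> \<rho> (\<lambda>t. u i t - \<rho> * J' (u i) t) \<and>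
    0 \<le> \<mu> \<and>
    (AE t in lborel. t \<in> {0..T} \<longrightarrow>
       P (\<lambda>t. u i t - \<rho> * J' (u i) t) t = u i t - \<rho> * J' (u i) t - \<rho> * \<mu> * \<psi> t * b\<^sub>u t) \<and>
    (\<integral>\<omega>. (LBINT t:{0..T}. y (u (Suc i)) t \<omega>) \<partial>M) \<le> \<delta>"
proof -
  interpret prob_space M by fact
  note F_def = \<open>F = augmented_filtration M W\<close>
  note \<psi> = \<open>solves_dual T b\<^sub>y \<psi>\<close>
  have T: "0 \<le> T" using \<open>0 < T\<close> by simp
  have by_bound: "\<forall>t\<in>{0..T}. \<bar>b\<^sub>y t\<bar> \<le> C\<^sub>b" and bu_bound: "\<forall>t\<in>{0..T}. \<bar>b\<^sub>u t\<bar> \<le> C\<^sub>b"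
    using \<open>\<And>t. t \<in> {0..T} \<Longrightarrow> \<bar>b\<^sub>y t\<bar> + \<bar>b\<^sub>u t\<bar> \<le> C\<^sub>b\<close> by force+
  note bu = \<open>set_borel_measurable lborel {0..T} b\<^sub>u\<close> bu_bound
  have state: "is_state M (augmented_filtration M W) T W (drift b\<^sub>y b\<^sub>u m) \<sigma> y0 v (y v)" if "v \<in> L2 T" for v
    using \<open>\<And>v. v \<in> L2 T \<Longrightarrow> is_state M F T W (drift b\<^sub>y b\<^sub>u m) \<sigma> y0 v (y v)\<close>[OF that]
    unfolding F_def .
  note by' = \<open>set_borel_measurable lborel {0..T} b\<^sub>y\<close> by_bound
  note mean = mean_time_integral_of_state[OF \<open>brownian_motion M T W\<close> T state by' \<psi>]

  define n where "n = (\<lambda>t. \<psi> t * b\<^sub>u t)"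
  define a where "a = \<psi> 0 * y0 + (LBINT t:{0..T}. \<psi> t * m t)"
  define w where "w = (\<lambda>t. u i t - \<rho> * J' (u i) t)"
  define K where "K = admissible_controls M T y \<delta>"
  obtain B where B: "\<forall>t\<in>{0..T}. \<bar>\<psi> t\<bar> \<le> B"
    using dual_measurable_bounded(2)[OF \<psi>] by blast
  note \<psi>_mult = set_integrable_bounded_mult[OF dual_measurable_bounded(1)[OF \<psi>] B]
  have n: "n \<in> L2 T"
    unfolding n_def
  proof (rule bounded_in_L2)
    show "set_borel_measurable lborel {0..T} (\<lambda>t. \<psi> t * b\<^sub>u t)"
      by (rule set_borel_measurable_mult[OF dual_measurable_bounded(1)[OF \<psi>] bu(1)])
    show "\<forall>t\<in>{0..T}. \<bar>\<psi> t * b\<^sub>u t\<bar> \<le> B * C\<^sub>b"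
      unfolding abs_mult using B bu_bound \<open>0 < C\<^sub>b\<close>
      by (meson mult_mono abs_ge_zero order_trans)
  qed
  have w: "w \<in> L2 T"
    unfolding w_def using \<open>u i \<in> L2 T\<close> \<open>continuous_L2_gradient T (objective M T y h j k) J'\<close>
    by (intro L2_diff_scaled) (auto simp: continuous_L2_gradient_def has_L2_gradient_def)
  have affine: "\<psi> 0 * y0 + (LBINT t:{0..T}. \<psi> t * (b\<^sub>u t * v t + m t)) = a + L2_inner T n v"
    if v: "v \<in> L2 T" for v
  proof -
    have buv: "set_integrable lborel {0..T} (\<lambda>t. b\<^sub>u t * v t)"
      by (rule set_integrable_bounded_mult[OF bu L2_integrable[OF v]])
    \<comment> \<open>Integrability of \<open>m\<close> is inherited from the existence of a state for \<open>v\<close>.\<close>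
    have "set_integrable lborel {0..T} (\<lambda>t. (b\<^sub>u t * v t + m t) - b\<^sub>u t * v t)"
      by (intro set_integral_diff(1) buv
          state_mean_equation(1)[OF \<open>brownian_motion M T W\<close> T state[OF v] by'])
    then have m: "set_integrable lborel {0..T} m" by simp
    have "(LBINT t:{0..T}. \<psi> t * (b\<^sub>u t * v t + m t))
        = (LBINT t:{0..T}. \<psi> t * (b\<^sub>u t * v t) + \<psi> t * m t)"
      by (simp add: distrib_left)
    also have "\<dots> = (LBINT t:{0..T}. \<psi> t * (b\<^sub>u t * v t)) + (LBINT t:{0..T}. \<psi> t * m t)"
      by (intro set_integral_add(2) \<psi>_mult buv m)
    finally show ?thesis by (simp add: a_def n_def L2_inner_def mult.assoc)
  qed
  have K: "K = {v \<in> L2 T. a + L2_inner T n v \<le> \<delta>}"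
    using mean(2) affine by (auto simp: K_def admissible_controls_def)
  have P: "P w \<in> K" "\<And>v. v \<in> K \<Longrightarrow> 0 \<le> L2_inner T (\<lambda>t. P w t - w t) (\<lambda>t. v t - P w t)"
    using \<open>is_L2_projection T (admissible_controls M T y \<delta>) P\<close> w
    by (auto simp: is_L2_projection_def K_def)

  define \<mu> where "\<mu> = explicit_multiplier T y0 b\<^sub>u m \<psi> \<delta> \<rho> w"
  have \<mu>: "\<mu> = max 0 (a + L2_inner T n w - \<delta>) / (\<rho> * L2_inner T n n)"
    unfolding \<mu>_def explicit_multiplier_def affine[OF w]
    by (simp add: n_def L2_inner_def power2_eq_square)
  have "0 \<le> \<mu>"
    unfolding \<mu> using L2_inner_self_nonneg[of T n] \<open>0 < \<rho>\<close> by simp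
  moreover have "AE t in lborel. t \<in> {0..T} \<longrightarrow> P w t = w t - \<rho> * \<mu> * \<psi> t * b\<^sub>u t"
  proof -
    have "\<rho> * \<mu> = max 0 (a + L2_inner T n w - \<delta>) / L2_inner T n n"
      using \<open>0 < \<rho>\<close> by (simp add: \<mu>)
    with L2_projection_halfspace[OF n w K P] show ?thesis
      by (simp add: n_def mult.assoc)
  qed
  moreover have "(\<integral>\<omega>. (LBINT t:{0..T}. y (P w) t \<omega>) \<partial>M) \<le> \<delta>"
    using P(1) mean(1)[of "P w"] by (simp add: K_def admissible_controls_def)
  moreover have "u (Suc i) = P w"
    unfolding w_def by fact
  ultimately show ?thesis
    by (intro exI[of _ \<mu>]) (simp add: \<mu>_def w_def)
qed

end
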